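(* Let $X$ be a finitely generated abelian group and $S$ a finite symmetric generating set of $X$ (i.e. $s\in S\Rightarrow s^{-1}\in S$, and the identity is not in $S$). Let $G$ be the Cayley graph of $X$ with respect to $S$, with vertex set $X$ and edges $\{g,gs\}$ for $g\in X$, $s\in S$. Then $\mathrm{Ric}(G)\ge 0$.
   Context: For a graph $G=(V,E)$ (undirected, simple, locally finite, no isolated vertices; $y\sim x$ means adjacency) and $f,g:V\to\mathbb R$ define $\Delta f(x)=\sum_{y\sim x}(f(y)-f(x))$, $\Gamma(f,g)(x)=\frac12\sum_{y\sim x}(f(x)-f(y))(g(x)-g(y))$, $\Gamma(f)=\Gamma(f,f)$, $\Gamma_2(f)=\frac12\Delta\Gamma(f)-\Gamma(f,\Delta f)$. "$\mathrm{Ric}(G)\ge K$" means $\Gamma_2(f)(x)\ge K\,\Gamma(f)(x)$ for all $f:V\to\mathbb R$ and all $x\in V$. *)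

theory Defs
  imports Complex_Main "HOL-Algebra.Generated_Groups"
begin

section \<open>Undirected graphs\<close>

text \<open>A graph is a pair of a vertex set and a set of two-element edges.\<close>

type_synonym 'a ugraph = "'a set \<times> 'a set set"

definition verts :: "'a ugraph \<Rightarrow> 'a set" where
  "verts G = fst G"

definition edges :: "'a ugraph \<Rightarrow> 'a set set" where
  "edges G = snd G"

definition nbrs :: "'a ugraph \<Rightarrow> 'a \<Rightarrow> 'a set" where
  "nbrs G x = {y \<in> verts G. {x, y} \<in> edges G}"

locale lf_simple_graph =
  fixes G :: "'a ugraph"
  assumes edge_subset: "e \<in> edges G \<Longrightarrow> e \<subseteq> verts G"
    and edge_card: "e \<in> edges G \<Longrightarrow> card e = 2"
    and locally_finite: "x \<in> verts G \<Longrightarrow> finite (nbrs G x)"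
    and no_isolated: "x \<in> verts G \<Longrightarrow> nbrs G x \<noteq> {}"


section \<open>Bakry--Emery curvature\<close>

text \<open>
  Functions on the vertex set are total functions on the ambient type; at a vertex, the operators
  below depend only on the values at vertices.
\<close>

definition laplacian :: "'a ugraph \<Rightarrow> ('a \<Rightarrow> real) \<Rightarrow> 'a \<Rightarrow> real" where
  "laplacian G f x = (\<Sum>y\<in>nbrs G x. f y - f x)"

definition Gam :: "'a ugraph \<Rightarrow> ('a \<Rightarrow> real) \<Rightarrow> ('a \<Rightarrow> real) \<Rightarrow> 'a \<Rightarrow> real" where
  "Gam G f g x = 1/2 * (\<Sum>y\<in>nbrs G x. (f x - f y) * (g x - g y))"

definition Gam2 :: "'a ugraph \<Rightarrow> ('a \<Rightarrow> real) \<Rightarrow> 'a \<Rightarrow> real" where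
  "Gam2 G f x = 1/2 * laplacian G (Gam G f f) x - Gam G f (laplacian G f) x"

definition Ric_ge :: "'a ugraph \<Rightarrow> real \<Rightarrow> bool" where
  "Ric_ge G K \<longleftrightarrow> (\<forall>f. \<forall>x\<in>verts G. Gam2 G f x \<ge> K * Gam G f f x)"


section \<open>Cayley graphs\<close>

definition cayley_graph :: "('a, 'b) monoid_scheme \<Rightarrow> 'a set \<Rightarrow> 'a ugraph" where
  "cayley_graph X S = (carrier X, {{g, g \<otimes>\<^bsub>X\<^esub> s} | g s. g \<in> carrier X \<and> s \<in> S})"

lemma nbrs_cayley_graph:
  fixes X (structure)
  assumes "group X" "S \<subseteq> carrier X" "\<And>s. s \<in> S \<Longrightarrow> inv s \<in> S" "x \<in> carrier X"
  shows "nbrs (cayley_graph X S) x = (\<lambda>s. x \<otimes> s) ` S"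
proof -
  interpret group X by fact
  have "y \<in> (\<lambda>s. x \<otimes> s) ` S"
    if xy: "{x, y} = {g, g \<otimes> s}" and "g \<in> carrier X" "s \<in> S" for y g s
  proof -
    have s: "s \<in> carrier X" using that assms(2) by auto
    consider "x = g" "y = g \<otimes> s" | "y = g" "x = g \<otimes> s"
      using xy unfolding doubleton_eq_iff by blast
    then show ?thesis
    proof cases
      case 1
      then show ?thesis using that by auto
    next
      case 2
      then have "y = x \<otimes> inv s" using s that(2) by (simp add: m_assoc)
      then show ?thesis using assms(3)[OF that(3)] by auto
    qed
  qed
  then have "nbrs (cayley_graph X S) x \<subseteq> (\<lambda>s. x \<otimes> s) ` S"
    by (auto simp: nbrs_def verts_def edges_def cayley_graph_def simp del: insert_iff)
  moreover have "x \<otimes> s \<in> nbrs (cayley_graph X S) x" if "s \<in> S" for s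
  proof -
    have "x \<otimes> s \<in> carrier X" using that assms(2,4) by auto
    then show ?thesis
      using that assms(4) unfolding nbrs_def verts_def edges_def cayley_graph_def fst_conv snd_conv
      by blast
  qed
  ultimately show ?thesis by blast
qed

lemma lf_simple_graph_cayley_graph:
  fixes X (structure)
  assumes "group X" "finite S" "S \<noteq> {}" "S \<subseteq> carrier X" "\<And>s. s \<in> S \<Longrightarrow> inv s \<in> S" "\<one> \<notin> S"
  shows "lf_simple_graph (cayley_graph X S)"
proof -
  interpret group X by fact
  have N: "nbrs (cayley_graph X S) x = (\<lambda>s. x \<otimes> s) ` S" if "x \<in> carrier X" for x
    using nbrs_cayley_graph[OF assms(1,4,5) that] by simp
  have V: "verts (cayley_graph X S) = carrier X"
    by (simp add: verts_def cayley_graph_def)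
  have E: "\<exists>g s. e = {g, g \<otimes> s} \<and> g \<in> carrier X \<and> s \<in> S"
    if "e \<in> edges (cayley_graph X S)" for e
    using that by (auto simp: edges_def cayley_graph_def)
  show ?thesis
  proof
    fix e assume "e \<in> edges (cayley_graph X S)"
    then obtain g s where e: "e = {g, g \<otimes> s}" "g \<in> carrier X" "s \<in> S"
      using E by blast
    then have s: "s \<in> carrier X" using assms(4) by auto
    show "e \<subseteq> verts (cayley_graph X S)" using e s V by auto
    have "g \<noteq> g \<otimes> s"
      using e s assms(6) l_cancel_one'[of g s] by auto
    then show "card e = 2" using e by simp
  qed (use V N assms(2,3) in auto)
qed

end

theory Submission
  imports Defs
begin

text \<open>
  Write \<open>a s = f (x s) - f x\<close> for the first differences at \<open>x\<close> and
  \<open>D s t = f (x s t) - f (x s) - f (x t) + f x\<close> for the second ones.  Then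
  \<open>\<Delta>\<Gamma>(f)/2 = 1/4 \<Sum>\<^sub>s \<Sum>\<^sub>t (2 a t D s t + (D s t)\<^sup>2)\<close> and
  \<open>\<Gamma>(f, \<Delta>f) = 1/2 \<Sum>\<^sub>s \<Sum>\<^sub>t a s D s t\<close>.  Commutativity makes \<open>D\<close> symmetric, so the
  mixed terms cancel and \<open>\<Gamma>\<^sub>2(f) = 1/4 \<Sum>\<^sub>s \<Sum>\<^sub>t (D s t)\<^sup>2\<close>.
\<close>

text \<open>Left translation by \<open>x\<close> is injective, so each neighbour of \<open>x\<close>
  comes from exactly one generator.\<close>

lemma sum_nbrs_cayley_graph:
  fixes X (structure)
  assumes "group X" "S \<subseteq> carrier X" "\<And>s. s \<in> S \<Longrightarrow> inv s \<in> S" "x \<in> carrier X"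
  shows "sum h (nbrs (cayley_graph X S) x) = (\<Sum>s\<in>S. h (x \<otimes> s))"
proof -
  interpret group X by fact
  have "inj_on (\<lambda>s. x \<otimes> s) S"
    using assms(2,4) by (auto intro!: inj_onI simp: subset_iff)
  then show ?thesis
    by (simp add: nbrs_cayley_graph assms sum.reindex)
qed

lemma Gam2_cayley_graph:
  fixes X (structure)
  assumes "comm_group X" "S \<subseteq> carrier X" "\<And>s. s \<in> S \<Longrightarrow> inv s \<in> S" "x \<in> carrier X"
  shows "Gam2 (cayley_graph X S) f x =
    1/4 * (\<Sum>s\<in>S. \<Sum>t\<in>S. (f (x \<otimes> s \<otimes> t) - f (x \<otimes> s) - f (x \<otimes> t) + f x)\<^sup>2)"
proof -
  interpret comm_group X by fact
  let ?G = "cayley_graph X S"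
  have sum_nbrs: "sum h (nbrs ?G y) = (\<Sum>s\<in>S. h (y \<otimes> s))" if "y \<in> carrier X"
    for h :: "'a \<Rightarrow> real" and y
    by (rule sum_nbrs_cayley_graph) (use assms that is_group in auto)
  have closed: "x \<otimes> s \<in> carrier X" if "s \<in> S" for s
    using that assms(2,4) by auto
  define a where "a s = f (x \<otimes> s) - f x" for s
  define D where "D s t = f (x \<otimes> s \<otimes> t) - f (x \<otimes> s) - f (x \<otimes> t) + f x" for s t
  have D_sym: "D s t = D t s" if "s \<in> S" "t \<in> S" for s t
  proof -
    have "s \<in> carrier X" "t \<in> carrier X" using that assms(2) by auto
    then have "x \<otimes> s \<otimes> t = x \<otimes> t \<otimes> s" using assms(4) by (simp add: m_ac)
    then show ?thesis by (simp add: D_def)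
  qed
  \<comment> \<open>Differences at \<open>x \<otimes> s\<close> and at \<open>x\<close> are paired
    along the same generator \<open>t\<close>, so \<open>Gam\<close> at the two vertices can be
    compared term by term.\<close>
  have diff: "f (x \<otimes> s \<otimes> t) - f (x \<otimes> s) = a t + D s t" for s t
    by (simp add: a_def D_def)
  have Gam_x: "Gam ?G f f x = 1/2 * (\<Sum>t\<in>S. (a t)\<^sup>2)"
    by (simp add: Gam_def sum_nbrs assms(4) a_def power2_eq_square algebra_simps)
  have Gam_xs: "Gam ?G f f (x \<otimes> s) = 1/2 * (\<Sum>t\<in>S. (a t + D s t)\<^sup>2)" if "s \<in> S" for s
    by (simp add: Gam_def sum_nbrs closed that diff[symmetric] power2_eq_square algebra_simps)
  have "laplacian ?G (Gam ?G f f) x = (\<Sum>s\<in>S. Gam ?G f f (x \<otimes> s) - Gam ?G f f x)"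
    by (simp add: laplacian_def sum_nbrs assms(4))
  also have "\<dots> = (\<Sum>s\<in>S. \<Sum>t\<in>S. a t * D s t + 1/2 * (D s t)\<^sup>2)"
  proof (rule sum.cong)
    fix s assume "s \<in> S"
    then have "Gam ?G f f (x \<otimes> s) - Gam ?G f f x
        = (\<Sum>t\<in>S. 1/2 * (a t + D s t)\<^sup>2 - 1/2 * (a t)\<^sup>2)"
      by (simp only: Gam_x Gam_xs sum_distrib_left sum_subtractf)
    also have "\<dots> = (\<Sum>t\<in>S. a t * D s t + 1/2 * (D s t)\<^sup>2)"
      by (rule sum.cong) (simp_all add: power2_eq_square field_simps)
    finally show "Gam ?G f f (x \<otimes> s) - Gam ?G f f x = \<dots>" .
  qed simp
  also have "\<dots> = (\<Sum>s\<in>S. \<Sum>t\<in>S. a t * D s t) + 1/2 * (\<Sum>s\<in>S. \<Sum>t\<in>S. (D s t)\<^sup>2)"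
    by (simp only: sum.distrib sum_distrib_left)
  \<comment> \<open>Exchanging the roles of \<open>s\<close> and \<open>t\<close> gives
    \<open>a s * D t s\<close>; symmetry of \<open>D\<close> then yields the form in which the mixed
    term appears in \<open>Gam ?G f (laplacian ?G f) x\<close>.\<close>
  also have "(\<Sum>s\<in>S. \<Sum>t\<in>S. a t * D s t) = (\<Sum>s\<in>S. \<Sum>t\<in>S. a s * D s t)"
    by (subst sum.swap) (simp add: D_sym cong: sum.cong)
  finally have lap_Gam: "laplacian ?G (Gam ?G f f) x =
      (\<Sum>s\<in>S. \<Sum>t\<in>S. a s * D s t) + 1/2 * (\<Sum>s\<in>S. \<Sum>t\<in>S. (D s t)\<^sup>2)" .
  have lap_diff: "laplacian ?G f (x \<otimes> s) - laplacian ?G f x = (\<Sum>t\<in>S. D s t)" if "s \<in> S" for s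
    unfolding laplacian_def sum_nbrs[OF closed[OF that]] sum_nbrs[OF assms(4)]
      sum_subtractf[symmetric]
    by (rule sum.cong) (simp_all add: D_def)
  \<comment> \<open>Both factors in \<open>Gam\<close> are differences from \<open>x\<close> to a
    neighbour with reversed sign, and the two signs cancel.\<close>
  have "Gam ?G f (laplacian ?G f) x =
      1/2 * (\<Sum>s\<in>S. a s * (laplacian ?G f (x \<otimes> s) - laplacian ?G f x))"
    by (simp add: Gam_def sum_nbrs assms(4) a_def algebra_simps)
  also have "\<dots> = 1/2 * (\<Sum>s\<in>S. \<Sum>t\<in>S. a s * D s t)"
    by (simp add: lap_diff sum_distrib_left)
  \<comment> \<open>The factor 1/2 in \<open>Gam2\<close> makes the two mixed terms equal; the
    squares keep 1/2 * 1/2.\<close>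
  finally have "Gam2 ?G f x = 1/4 * (\<Sum>s\<in>S. \<Sum>t\<in>S. (D s t)\<^sup>2)"
    by (simp only: Gam2_def lap_Gam) (simp add: distrib_left)
  then show ?thesis by (simp only: D_def)
qed

theorem theorem5:
  fixes X :: "('a, 'b) monoid_scheme" (structure) and S :: "'a set"
  assumes "comm_group X"
    and "finite S" and "S \<subseteq> carrier X" and "generate X S = carrier X"
    and "\<And>s. s \<in> S \<Longrightarrow> inv s \<in> S" and "\<one> \<notin> S"
  shows "Ric_ge (cayley_graph X S) 0"
  unfolding Ric_ge_def
proof (intro allI ballI)
  fix f x assume "x \<in> verts (cayley_graph X S)"
  then have "x \<in> carrier X" by (simp add: verts_def cayley_graph_def)
  then show "0 * Gam (cayley_graph X S) f f x \<le> Gam2 (cayley_graph X S) f x"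
    by (simp add: Gam2_cayley_graph assms sum_nonneg)
qed

end
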